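(* For every $\varepsilon\in[0,1]$: if $G$ is a bipartite graph such that $\omega(L(G)^2)\geq(1-\varepsilon)\Delta(G)^2$, then $G$ contains a subgraph isomorphic to $K_{r,r}$ where $r=(1-\sqrt{8}\,\varepsilon^{1/4})\Delta(G)$.
   Context: For a graph $G$, $L(G)^2$ denotes the square of the line graph of $G$: its vertices are the edges of $G$, and two distinct edges $e,f$ of $G$ are adjacent in $L(G)^2$ if and only if they share an end, or some edge of $G$ joins an end of $e$ to an end of $f$. $\omega$ denotes the clique number, $\Delta(G)$ the maximum degree, and $K_{r,r}$ the complete bipartite graph with both parts of size $r$. *)

theory Defs imports Complex_Main begin

record 'a ugraph =
  verts :: "'a set"
  edges :: "'a set set"

definition simple_graph :: "'a ugraph \<Rightarrow> bool" where
  "simple_graph G \<longleftrightarrow> (\<forall>e\<in>edges G. e \<subseteq> verts G \<and> card e = 2)"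

definition finite_simple_graph :: "'a ugraph \<Rightarrow> bool" where
  "finite_simple_graph G \<longleftrightarrow> finite (verts G) \<and> simple_graph G"

definition degree :: "'a ugraph \<Rightarrow> 'a \<Rightarrow> nat" where
  "degree G v = card {e \<in> edges G. v \<in> e}"

(* Inserting 0 only matters for the graph without vertices, whose maximum degree is 0. *)
definition max_degree :: "'a ugraph \<Rightarrow> nat" where
  "max_degree G = Max (insert 0 (degree G ` verts G))"

definition bipartite :: "'a ugraph \<Rightarrow> bool" where
  "bipartite G \<longleftrightarrow>
     (\<exists>A B. A \<union> B = verts G \<and> A \<inter> B = {} \<and> (\<forall>e\<in>edges G. \<exists>a\<in>A. \<exists>b\<in>B. e = {a, b}))"

definition line_graph_square :: "'a ugraph \<Rightarrow> 'a set ugraph" where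
  "line_graph_square G =
     \<lparr> verts = edges G,
       edges = {{e, f} | e f. e \<in> edges G \<and> f \<in> edges G \<and> e \<noteq> f \<and>
                  (e \<inter> f \<noteq> {} \<or> (\<exists>x\<in>e. \<exists>y\<in>f. {x, y} \<in> edges G))} \<rparr>"

definition clique :: "'a ugraph \<Rightarrow> 'a set \<Rightarrow> bool" where
  "clique G K \<longleftrightarrow> K \<subseteq> verts G \<and> (\<forall>u\<in>K. \<forall>v\<in>K. u \<noteq> v \<longrightarrow> {u, v} \<in> edges G)"

(* Meaningful for finite graphs; the empty set is a clique, so the maximum is over a nonempty set. *)
definition clique_number :: "'a ugraph \<Rightarrow> nat" where
  "clique_number G = Max (card ` {K. clique G K})"

definition complete_bipartite :: "nat \<Rightarrow> nat \<Rightarrow> (nat + nat) ugraph" where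
  "complete_bipartite m n =
     \<lparr> verts = Inl ` {..<m} \<union> Inr ` {..<n},
       edges = {{Inl i, Inr j} | i j. i < m \<and> j < n} \<rparr>"

definition subgraph :: "'a ugraph \<Rightarrow> 'a ugraph \<Rightarrow> bool" where
  "subgraph H G \<longleftrightarrow> simple_graph H \<and> verts H \<subseteq> verts G \<and> edges H \<subseteq> edges G"

definition isomorphic :: "'a ugraph \<Rightarrow> 'b ugraph \<Rightarrow> bool" where
  "isomorphic G H \<longleftrightarrow>
     (\<exists>f. bij_betw f (verts G) (verts H) \<and>
          (\<forall>u\<in>verts G. \<forall>v\<in>verts G. {u, v} \<in> edges G \<longleftrightarrow> {f u, f v} \<in> edges H))"

end

theory Submission imports Defs begin

text \<open>
  View \<open>G\<close> as a relation \<open>E\<close> between its two sides, and a maximum clique of the square of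
  the line graph as \<open>K \<subseteq> E\<close>, so that \<open>(a, b), (a', b') \<in> K\<close> forces
  \<open>(a, b') \<in> E\<close> or \<open>(a', b) \<in> E\<close>. Hence a non-edge \<open>(a, b')\<close> of \<open>G\<close> makes
  \<open>K\<close>-neighbourhoods of \<open>a\<close> and \<open>b'\<close> complete to each other. So either two
  nonadjacent vertices of \<open>K\<close>-degree at least \<open>r\<close> yield the biclique, or all such vertices on
  the two sides are adjacent and it remains to find \<open>r\<close> of them on each side.
  For this, let \<open>d\<close> be the maximum \<open>K\<close>-degree, attained at \<open>a\<close>. Each edge of \<open>K\<close> has an
  end in \<open>N\<^sub>G(a)\<close> or an end that is \<open>G\<close>-adjacent to all of \<open>N\<^sub>K(a)\<close>; counting gives
  \<open>|K| \<le> d (2 \<Delta> - d)\<close>, so that \<open>d\<close> is close to \<open>\<Delta>\<close>, and shows that nearly all edges of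
  \<open>K\<close> meet \<open>N\<^sub>K(a)\<close>. So most vertices of \<open>N\<^sub>K(a)\<close> have large \<open>K\<close>-degree, and the same
  argument at the best of them treats the other side.
\<close>

section \<open>Bipartite graphs as relations, and edge counts by degrees\<close>

text \<open>Adjacency in the square of the line graph, for the edges \<open>K\<close> of a clique
  and the edges \<open>E\<close> of the graph: if \<open>K \<subseteq> E\<close>, two members of
  \<open>K\<close> with a common end satisfy it automatically.\<close>

definition cross_linked :: "('a \<times> 'b) set \<Rightarrow> ('a \<times> 'b) set \<Rightarrow> bool" where
  "cross_linked E K \<longleftrightarrow> (\<forall>a b a' b'. (a, b) \<in> K \<longrightarrow> (a', b') \<in> K \<longrightarrow> (a, b') \<in> E \<or> (a', b) \<in> E)"

definition degrees_le :: "('a \<times> 'b) set \<Rightarrow> nat \<Rightarrow> bool" where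
  "degrees_le E n \<longleftrightarrow> (\<forall>a. card (E `` {a}) \<le> n) \<and> (\<forall>b. card (E\<inverse> `` {b}) \<le> n)"

lemma cross_linked_converse: "cross_linked E K \<Longrightarrow> cross_linked (E\<inverse>) (K\<inverse>)"
  unfolding cross_linked_def by blast

lemma degrees_le_converse: "degrees_le E n \<Longrightarrow> degrees_le (E\<inverse>) n"
  unfolding degrees_le_def by simp

lemma card_edges_into:
  assumes "finite K" "finite N"
  shows "card {p \<in> K. snd p \<in> N} = (\<Sum>y\<in>N. card (K\<inverse> `` {y}))"
proof -
  have "{p \<in> K. snd p \<in> N} = prod.swap ` (SIGMA y:N. K\<inverse> `` {y})"
    by force
  then have "card {p \<in> K. snd p \<in> N} = card (SIGMA y:N. K\<inverse> `` {y})"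
    by (simp add: card_image)
  also have "\<dots> = (\<Sum>y\<in>N. card (K\<inverse> `` {y}))"
    using assms by (intro card_SigmaI) (auto intro: finite_Image)
  finally show ?thesis .
qed

lemma card_edges_into_le:
  assumes "finite K" "finite N" "\<And>y. y \<in> N \<Longrightarrow> card (K\<inverse> `` {y}) \<le> m"
  shows "card {p \<in> K. snd p \<in> N} \<le> card N * m"
  using sum_bounded_above[of N "\<lambda>y. card (K\<inverse> `` {y})" m] card_edges_into[of K N] assms by simp

lemma card_edges_from_le:
  assumes "finite K" "finite X" "\<And>x. x \<in> X \<Longrightarrow> card (K `` {x}) \<le> m"
  shows "card {p \<in> K. fst p \<in> X} \<le> card X * m"
proof -
  have "{p \<in> K. fst p \<in> X} = prod.swap ` {p \<in> K\<inverse>. snd p \<in> X}"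
    by force
  then have "card {p \<in> K. fst p \<in> X} = card {p \<in> K\<inverse>. snd p \<in> X}"
    by (simp add: card_image)
  with card_edges_into_le[of "K\<inverse>" X m] assms show ?thesis
    by simp
qed

section \<open>Counting the edges of \<open>K\<close> around a vertex\<close>

text \<open>Compare \<open>(x, y)\<close> with each edge \<open>(a, b)\<close> of \<open>K\<close>:
  as \<open>(a, y)\<close> is not in \<open>E\<close>, \<open>(x, b)\<close> must be. The two counts
  below use linkedness only in this form.\<close>

lemma cross_linked_cases:
  assumes "cross_linked E K" "(x, y) \<in> K" "y \<notin> E `` {a}"
  shows "K `` {a} \<subseteq> E `` {x}"
  using assms unfolding cross_linked_def by blast

text \<open>Such an edge either ends at one of at most \<open>n - card ?N\<close> further
  \<open>E\<close>-neighbours of \<open>a\<close>, each of \<open>K\<close>-degree at most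
  \<open>m\<close>, or starts in \<open>?X\<close>. All of \<open>?X\<close> is adjacent to any
  fixed \<open>b\<close> in \<open>?N\<close>, so \<open>?X\<close> has at most \<open>n\<close>
  vertices, and each has at most \<open>n - card ?N\<close> neighbours outside
  \<open>?N\<close>.\<close>

lemma card_edges_avoiding_le:
  assumes fin: "finite E" and sub: "K \<subseteq> E" and cl: "cross_linked E K"
    and E: "degrees_le E n" and K: "degrees_le K m" and ne: "K `` {a} \<noteq> {}"
  shows "card {p \<in> K. snd p \<notin> K `` {a}} \<le> (n - card (K `` {a})) * (n + m)"
proof -
  let ?N = "K `` {a}"
  let ?X = "{x. ?N \<subseteq> E `` {x}}"
  let ?P = "{p \<in> K. snd p \<in> E `` {a} - ?N}"
  let ?Q = "{p \<in> {p \<in> K. snd p \<notin> ?N}. fst p \<in> ?X}"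
  have finK: "finite K" using fin sub finite_subset by blast
  have finN: "finite ?N" using finK by (rule finite_Image)
  obtain b where b: "b \<in> ?N" using ne by blast
  have subX: "?X \<subseteq> E\<inverse> `` {b}" using b by auto
  have finEb: "finite (E\<inverse> `` {b})" using fin by (simp add: finite_Image)
  have cardX: "card ?X \<le> n"
    using card_mono[OF finEb subX] E unfolding degrees_le_def by (meson le_trans)
  have finX: "finite ?X" using subX finEb finite_subset by blast
  have diff: "card (E `` {x} - ?N) \<le> n - card ?N" if "?N \<subseteq> E `` {x}" for x
    using E that finN unfolding degrees_le_def by (simp add: card_Diff_subset diff_le_mono)
  have "card ?P \<le> card (E `` {a} - ?N) * m"
    using K unfolding degrees_le_def
    by (intro card_edges_into_le finK finite_Diff finite_Image fin) auto
  also have "\<dots> \<le> (n - card ?N) * m"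
    using diff[of a] sub by (intro mult_right_mono) auto
  finally have P: "card ?P \<le> (n - card ?N) * m" .
  have "card ({p \<in> K. snd p \<notin> ?N} `` {x}) \<le> n - card ?N" if "x \<in> ?X" for x
  proof -
    have "{p \<in> K. snd p \<notin> ?N} `` {x} \<subseteq> E `` {x} - ?N" using sub by auto
    then have "card ({p \<in> K. snd p \<notin> ?N} `` {x}) \<le> card (E `` {x} - ?N)"
      by (intro card_mono finite_Diff finite_Image fin)
    with diff[of x] that show ?thesis by auto
  qed
  then have "card ?Q \<le> card ?X * (n - card ?N)"
    using finK finX by (intro card_edges_from_le) auto
  also have "\<dots> \<le> n * (n - card ?N)" using cardX by (rule mult_right_mono) simp
  finally have Q: "card ?Q \<le> n * (n - card ?N)" .
  have "{p \<in> K. snd p \<notin> ?N} \<subseteq> ?P \<union> ?Q"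
    using cross_linked_cases[OF cl] by fastforce
  then have "card {p \<in> K. snd p \<notin> ?N} \<le> card (?P \<union> ?Q)"
    using finK by (intro card_mono) auto
  also have "\<dots> \<le> card ?P + card ?Q" by (rule card_Un_le)
  also have "\<dots> \<le> (n - card ?N) * m + n * (n - card ?N)" using P Q by (rule add_mono)
  also have "\<dots> = (n - card ?N) * (n + m)" by (metis add.commute distrib_left mult.commute)
  finally show ?thesis .
qed

text \<open>Besides the edges \<open>?P\<close> into further \<open>E\<close>-neighbours of
  \<open>a\<close>, there are the edges \<open>?Q\<close> from \<open>?X\<close> and the edges
  \<open>?R\<close> into \<open>?N\<close> from outside \<open>?X\<close>. A vertex of
  \<open>?N\<close> is \<open>E\<close>-adjacent to all of \<open>?X\<close>, so it has at most
  \<open>n - card ?X\<close> other neighbours: a large \<open>?X\<close> makes \<open>?R\<close>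
  small.\<close>

lemma card_cross_linked_le:
  assumes fin: "finite E" and sub: "K \<subseteq> E" and cl: "cross_linked E K"
    and E: "degrees_le E n" and K: "degrees_le K (card (K `` {a}))" and ne: "K `` {a} \<noteq> {}"
  shows "card K \<le> card (K `` {a}) * (n + (n - card (K `` {a})))"
proof -
  let ?N = "K `` {a}" and ?d = "card (K `` {a})"
  let ?X = "{x. ?N \<subseteq> E `` {x}}"
  let ?P = "{p \<in> K. snd p \<in> E `` {a} - ?N}"
  let ?Q = "{p \<in> K. fst p \<in> ?X}"
  let ?R = "{p \<in> {p \<in> K. fst p \<notin> ?X}. snd p \<in> ?N}"
  have finK: "finite K" using fin sub finite_subset by blast
  have finN: "finite ?N" using finK by (rule finite_Image)
  have subX: "?X \<subseteq> E\<inverse> `` {b}" if "b \<in> ?N" for b using that by auto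
  have finEb: "finite (E\<inverse> `` {b})" for b using fin by (simp add: finite_Image)
  obtain b0 where b0: "b0 \<in> ?N" using ne by blast
  have finX: "finite ?X" using subX[OF b0] finEb finite_subset by blast
  have cardX: "card ?X \<le> n"
    using card_mono[OF finEb subX[OF b0]] E unfolding degrees_le_def by (meson le_trans)
  have "card ?P \<le> card (E `` {a} - ?N) * ?d"
    using K unfolding degrees_le_def
    by (intro card_edges_into_le finK finite_Diff finite_Image fin) auto
  also have "\<dots> \<le> (n - ?d) * ?d"
  proof (intro mult_right_mono)
    have "?N \<subseteq> E `` {a}" using sub by auto
    then show "card (E `` {a} - ?N) \<le> n - ?d"
      using E finN unfolding degrees_le_def by (simp add: card_Diff_subset diff_le_mono)
  qed simp
  finally have P: "card ?P \<le> (n - ?d) * ?d" .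
  have Q: "card ?Q \<le> card ?X * ?d"
    using K finX finK unfolding degrees_le_def by (intro card_edges_from_le) auto
  have "card ({p \<in> K. fst p \<notin> ?X}\<inverse> `` {y}) \<le> n - card ?X" if "y \<in> ?N" for y
  proof -
    have "{p \<in> K. fst p \<notin> ?X}\<inverse> `` {y} \<subseteq> E\<inverse> `` {y} - ?X" using sub by auto
    then have "card ({p \<in> K. fst p \<notin> ?X}\<inverse> `` {y}) \<le> card (E\<inverse> `` {y} - ?X)"
      by (intro card_mono finite_Diff finEb)
    also have "\<dots> \<le> n - card ?X"
      using E finX subX[OF that] unfolding degrees_le_def
      by (simp add: card_Diff_subset diff_le_mono)
    finally show ?thesis .
  qed
  then have R: "card ?R \<le> ?d * (n - card ?X)"
    using finK finN by (intro card_edges_into_le) auto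
  have "K \<subseteq> ?P \<union> (?Q \<union> ?R)"
    using cross_linked_cases[OF cl] by fastforce
  then have "card K \<le> card (?P \<union> (?Q \<union> ?R))"
    using finK by (intro card_mono) auto
  also have "\<dots> \<le> card ?P + (card ?Q + card ?R)"
    by (meson card_Un_le add_left_mono le_trans)
  also have "\<dots> \<le> (n - ?d) * ?d + (card ?X * ?d + ?d * (n - card ?X))"
    using P Q R by linarith
  \<comment> \<open>The bounds for \<open>?Q\<close> and \<open>?R\<close> add up to
    \<open>?d * n\<close>, whatever the size of \<open>?X\<close>.\<close>
  also have "card ?X * ?d + ?d * (n - card ?X) = ?d * (card ?X + (n - card ?X))"
    by (simp only: distrib_left mult.commute)
  also have "card ?X + (n - card ?X) = n" using cardX by simp
  also have "(n - ?d) * ?d + ?d * n = ?d * (n + (n - ?d))"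
    by (simp only: distrib_left mult.commute add.commute)
  finally show ?thesis .
qed

section \<open>Many neighbours of large \<open>K\<close>-degree\<close>

lemma sum_lt_of_few_large:
  fixes f :: "'a \<Rightarrow> real" and m r :: real
  assumes "finite N" "\<And>y. y \<in> N \<Longrightarrow> f y \<le> m" "card {y \<in> N. r \<le> f y} < card N"
  shows "(\<Sum>y\<in>N. f y) < card {y \<in> N. r \<le> f y} * m + (real (card N) - card {y \<in> N. r \<le> f y}) * r"
proof -
  let ?B = "{y \<in> N. r \<le> f y}" and ?C = "{y \<in> N. \<not> r \<le> f y}"
  have un: "N = ?B \<union> ?C" by auto
  have "card N = card ?B + card ?C"
    using assms(1) by (subst un, intro card_Un_disjoint) auto
  then have C: "real (card ?C) = real (card N) - card ?B" "card ?C > 0"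
    using assms(3) by auto
  have "(\<Sum>y\<in>N. f y) = (\<Sum>y\<in>?B. f y) + (\<Sum>y\<in>?C. f y)"
    using assms(1) by (subst un, intro sum.union_disjoint) auto
  moreover have "(\<Sum>y\<in>?B. f y) \<le> card ?B * m"
    using assms(2) by (intro sum_bounded_above) auto
  moreover have "(\<Sum>y\<in>?C. f y) < card ?C * r"
    using C(2) by (intro sum_bounded_above_strict) auto
  ultimately show ?thesis using C(1) by simp
qed

text \<open>The sum of the \<open>K\<close>-degrees over the neighbourhood of \<open>a\<close> is at
  most \<open>m\<close> times its size. The left side of \<open>slack\<close> bounds how far it
  falls short of that; the right side is the shortfall when exactly \<open>r\<close> vertices have
  degree \<open>m\<close> and all others degree \<open>r\<close>. Fewer than \<open>r\<close>
  vertices of degree at least \<open>r\<close> would make the shortfall larger.\<close>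

lemma heavy_neighbours:
  fixes r s :: real and n m :: nat
  assumes fin: "finite E" and sub: "K \<subseteq> E" and cl: "cross_linked E K"
    and E: "degrees_le E n" and K: "degrees_le K m" and ne: "K `` {a} \<noteq> {}"
    and s: "s \<le> card K" and rm: "r \<le> m" and rk: "r \<le> card (K `` {a})"
    and slack: "real m * card (K `` {a}) + (real n - card (K `` {a})) * (real n + real m) - s
                  \<le> (card (K `` {a}) - r) * (m - r)"
  shows "r \<le> card {y \<in> K `` {a}. r \<le> card (K\<inverse> `` {y})}"
    and "s - (real n - card (K `` {a})) * (real n + real m) \<le> (\<Sum>y\<in>K `` {a}. real (card (K\<inverse> `` {y})))"
proof -
  let ?N = "K `` {a}" and ?k = "card (K `` {a})"
  let ?B = "{y \<in> ?N. r \<le> card (K\<inverse> `` {y})}"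
  have finK: "finite K" using fin sub finite_subset by blast
  have finN: "finite ?N" using finK by (rule finite_Image)
  have kn: "?k \<le> n"
  proof -
    have "?k \<le> card (E `` {a})" using sub by (intro card_mono finite_Image fin) auto
    then show ?thesis using E unfolding degrees_le_def by (meson le_trans)
  qed
  have "K = {p \<in> K. snd p \<in> ?N} \<union> {p \<in> K. snd p \<notin> ?N}" by blast
  from arg_cong[OF this, of card]
  have "card K \<le> card {p \<in> K. snd p \<in> ?N} + card {p \<in> K. snd p \<notin> ?N}"
    using card_Un_le[of "{p \<in> K. snd p \<in> ?N}" "{p \<in> K. snd p \<notin> ?N}"] by linarith
  also have "\<dots> \<le> (\<Sum>y\<in>?N. card (K\<inverse> `` {y})) + (n - ?k) * (n + m)"
    unfolding card_edges_into[OF finK finN]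
    by (rule add_left_mono, rule card_edges_avoiding_le[OF fin sub cl E K ne])
  finally have "real (card K) \<le> real ((\<Sum>y\<in>?N. card (K\<inverse> `` {y})) + (n - ?k) * (n + m))"
    by (simp only: of_nat_le_iff)
  then show sum: "s - (real n - ?k) * (real n + real m) \<le> (\<Sum>y\<in>?N. real (card (K\<inverse> `` {y})))"
    using s kn by (simp add: of_nat_diff)
  show "r \<le> card ?B"
  proof (rule ccontr)
    assume "\<not> r \<le> card ?B"
    then have lt: "card ?B < r" by simp
    then have "card ?B < ?k" using rk by linarith
    then have "(\<Sum>y\<in>?N. real (card (K\<inverse> `` {y}))) < card ?B * real m + (real ?k - card ?B) * r"
      using K unfolding degrees_le_def by (intro sum_lt_of_few_large finN) auto
    with sum slack have "(?k - r) * (m - r) > real m * ?k - card ?B * real m - (real ?k - card ?B) * r"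
      by linarith
    \<comment> \<open>The right side above is \<open>(?k - card ?B) * (m - r)\<close>, so the
      difference of the two sides factors.\<close>
    then have "(card ?B - r) * (m - r) > 0" by (simp add: algebra_simps)
    moreover have "(card ?B - r) * (m - r) \<le> 0"
      using lt rm by (intro mult_nonpos_nonneg) auto
    ultimately show False by linarith
  qed
qed

section \<open>The biclique inside a relation\<close>

text \<open>The core estimate, for a vertex \<open>a\<close> whose \<open>K\<close>-degree is
  largest among both sides. Here \<open>u\<close> plays the fourth root of the density loss, which
  keeps all inequalities polynomial apart from \<open>sqrt 8\<close>.\<close>

lemma biclique_of_large_degree:
  fixes r u :: real
  assumes fin: "finite E" and sub: "K \<subseteq> E" and cl: "cross_linked E K"
    and E: "degrees_le E n" and K: "degrees_le K (card (K `` {a}))"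
    and u: "0 \<le> u" and card: "(1 - u ^ 4) * (real n)\<^sup>2 \<le> card K"
    and r: "r = (1 - sqrt 8 * u) * n" and rpos: "0 < r"
  shows "\<exists>S T. S \<times> T \<subseteq> E \<and> r \<le> card S \<and> r \<le> card T"
proof -
  let ?N = "K `` {a}"
  define d where "d = card ?N"
  have finK: "finite K" using fin sub finite_subset by blast
  have npos: "real n > 0" using rpos r by (cases "n = 0") auto
  \<comment> \<open>A rational stand-in for \<open>sqrt 8\<close>, since the square of 14/5 is 7.84.
    Positivity of \<open>r\<close> then forces \<open>u < 5/14\<close>, on which the bounds for
    \<open>u^2\<close> and \<open>u^4\<close> rest.\<close>
  have s8: "sqrt 8 \<ge> (14/5 :: real)" by (rule real_le_rsqrt) (simp add: power2_eq_square)
  have "sqrt 8 * u < 1" using rpos r npos by (simp add: zero_less_mult_iff)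
  moreover have su: "14/5 * u \<le> sqrt 8 * u" using s8 u by (intro mult_right_mono) auto
  ultimately have u38: "u < 5/14" by linarith
  have u2: "u^2 \<le> 5/14 * u" using mult_right_mono[of u "5/14" u] u u38 by (simp add: power2_eq_square)
  have u24: "u^2 \<le> 1/4" using u2 u38 by simp
  then have "u^2 * u^2 \<le> u^2 * (1/4)" by (intro mult_left_mono) auto
  then have u4: "u^4 \<le> u^2 * (1/4)" by (simp add: power4_eq_xxxx power2_eq_square mult.assoc)
  have rle: "r \<le> (1 - 14/5 * u) * n"
    unfolding r using su npos by (intro mult_right_mono) auto
  have "K \<noteq> {}"
  proof
    assume "K = {}"
    then have "(1 - u^4) * (real n)\<^sup>2 \<le> 0" using card by simp
    moreover have "0 < (1 - u^4) * (real n)\<^sup>2" using u4 u24 npos by (intro mult_pos_pos) auto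
    ultimately show False by linarith
  qed
  then obtain x y where xy: "(x, y) \<in> K" by auto
  have "card (K `` {x}) > 0"
    using xy finK by (auto simp: card_gt_0_iff finite_Image)
  then have "card ?N > 0" using K unfolding degrees_le_def by (meson less_le_trans)
  then have ne: "?N \<noteq> {}" by auto
  have dn: "d \<le> n"
  proof -
    have "d \<le> card (E `` {a})"
      unfolding d_def using sub by (intro card_mono finite_Image fin) auto
    then show ?thesis using E unfolding degrees_le_def by (meson le_trans)
  qed
  have "real (card K) \<le> real (d * (n + (n - d)))"
    using card_cross_linked_le[OF fin sub cl E K ne] unfolding d_def by (simp only: of_nat_le_iff)
  also have "\<dots> = real d * (2 * real n - real d)" using dn by (simp add: of_nat_diff)
  finally have "(1 - u^4) * (real n)\<^sup>2 \<le> real d * (2 * real n - real d)" using card by linarith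
  \<comment> \<open>Complete the square: \<open>d * (2 * n - d)\<close> is the square of
    \<open>n\<close> minus the square of \<open>n - d\<close>.\<close>
  then have "(real n - d)\<^sup>2 \<le> (u^2 * n)\<^sup>2"
    by (simp add: power2_eq_square power4_eq_xxxx algebra_simps)
  then have d: "real n - d \<le> u^2 * n" by (rule power2_le_imp_le) (simp add: npos)
  \<comment> \<open>\<open>d\<close> loses at most \<open>u^2 * n\<close>, hence at most
    \<open>5/14 * u * n\<close>, against a gap of at least \<open>14/5 * u * n\<close> between
    \<open>n\<close> and \<open>r\<close>. The same margin survives for \<open>e\<close>
    below.\<close>
  have rd: "d - r \<ge> 2 * u * n"
  proof -
    have "2 * u * n \<le> (14/5 * u - u^2) * n"
      using u2 u npos by (intro mult_right_mono) auto
    then show ?thesis using d rle by (simp add: algebra_simps)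
  qed
  have un: "0 \<le> 2 * u * n" using u by simp
  \<comment> \<open>So the squared margin is at least 16 times
    \<open>u^4 * (real n)\<^sup>2\<close>, which covers the slack of 1 and 3 such terms required at
    \<open>a\<close> and at \<open>b\<close>.\<close>
  have un4: "4 * (u^4 * (real n)\<^sup>2) \<le> (u * n) * (u * n)"
    using mult_right_mono[OF u4, of "(real n)\<^sup>2"] by (simp add: power2_eq_square ac_simps)
  have nonneg: "0 \<le> u^4 * (real n)\<^sup>2" by simp
  have four: "(2 * u * n) * (2 * u * n) = 4 * ((u * n) * (u * n))" by simp
  have slack1: "u^4 * (real n)\<^sup>2 \<le> (d - r) * (d - r)"
  proof -
    have "(2 * u * n) * (2 * u * n) \<le> (d - r) * (d - r)"
      using rd un by (intro mult_mono) auto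
    then show ?thesis using un4 nonneg four by linarith
  qed
  \<comment> \<open>At \<open>a\<close> the degree bound and the neighbourhood size are both
    \<open>d\<close>, and everything cancels except the deficit allowed in
    \<open>card K\<close>.\<close>
  have *: "real d * d + (real n - d) * (real n + real d) - (1 - u^4) * (real n)\<^sup>2 = u^4 * (real n)\<^sup>2"
    by (simp add: power2_eq_square algebra_simps)
  have hn: "r \<le> card {y \<in> ?N. r \<le> card (K\<inverse> `` {y})}"
    and sum: "(1 - u^4) * (real n)\<^sup>2 - (real n - card ?N) * (real n + real d) \<le> (\<Sum>y\<in>?N. real (card (K\<inverse> `` {y})))"
    using heavy_neighbours[OF fin sub cl E K ne card, of r] rd un slack1 *
    unfolding d_def by auto
  have finN: "finite ?N" using finK by (rule finite_Image)
  \<comment> \<open>The best vertex \<open>b\<close> of \<open>?N\<close> serves as the centre for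
    the other side. Since \<open>d * e\<close> bounds the degree sum, \<open>d * (d - e)\<close> is
    at most \<open>u^4 * (real n)\<^sup>2\<close>, and \<open>d\<close> is at least
    \<open>n / 2\<close>.\<close>
  define e where "e = Max ((\<lambda>y. card (K\<inverse> `` {y})) ` ?N)"
  have "e \<in> (\<lambda>y. card (K\<inverse> `` {y})) ` ?N" unfolding e_def using finN ne by (intro Max_in) auto
  then obtain b where b: "b \<in> ?N" "e = card (K\<inverse> `` {b})" by auto
  have "card (K\<inverse> `` {y}) \<le> e" if "y \<in> ?N" for y
    unfolding e_def using finN that by (intro Max_ge) auto
  then have "(\<Sum>y\<in>?N. real (card (K\<inverse> `` {y}))) \<le> d * real e"
    unfolding d_def by (intro sum_bounded_above) auto
  with sum * have "real d * (d - real e) \<le> u^4 * (real n)\<^sup>2"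
    unfolding d_def[symmetric] by (simp add: algebra_simps)
  moreover have "e \<le> d" using K b unfolding degrees_le_def d_def by auto
  moreover have "real n / 2 \<le> d"
    using d mult_right_mono[OF u24, of "real n"] by linarith
  ultimately have "real n / 2 * (d - real e) \<le> u^4 * (real n)\<^sup>2"
    using mult_right_mono[of "real n / 2" d "d - real e"] by simp
  then have "real n * (d - real e) \<le> real n * (2 * (u^4 * real n))"
    by (simp add: power2_eq_square algebra_simps)
  then have e: "d - real e \<le> 2 * (u^4 * real n)" using npos by simp
  have re: "e - r \<ge> 2 * u * n"
  proof -
    have "2 * u * n \<le> (14/5 * u - u^2 - 2 * u^4) * n"
      using u2 u4 u npos by (intro mult_right_mono) auto
    then show ?thesis using d e rle by (simp add: algebra_simps)
  qed
  have slack2: "3 * (u^4 * (real n)\<^sup>2) \<le> (e - r) * (d - r)"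
  proof -
    have "(2 * u * n) * (2 * u * n) \<le> (e - r) * (d - r)"
      using rd re un by (intro mult_mono) auto
    then show ?thesis using un4 nonneg four by linarith
  qed
  \<comment> \<open>At \<open>b\<close> the neighbourhood size is \<open>e\<close> but the degree
    bound remains \<open>d\<close>; this adds \<open>n * (d - e)\<close> to the previous
    deficit.\<close>
  have **: "real d * e + (real n - e) * (real n + real d) - (1 - u^4) * (real n)\<^sup>2 \<le> 3 * (u^4 * (real n)\<^sup>2)"
    using mult_left_mono[OF e, of "real n"] by (simp add: power2_eq_square algebra_simps)
  have ha: "r \<le> card {x \<in> K\<inverse> `` {b}. r \<le> card (K `` {x})}"
    using heavy_neighbours(1)[of "E\<inverse>" "K\<inverse>" n d b "(1 - u^4) * (real n)\<^sup>2" r]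
      fin sub cross_linked_converse[OF cl] degrees_le_converse[OF E]
      degrees_le_converse[OF K] b card rd re un slack2 **
    unfolding d_def by auto
  let ?S = "{x \<in> K\<inverse> `` {b}. r \<le> card (K `` {x})}" and ?T = "{y \<in> ?N. r \<le> card (K\<inverse> `` {y})}"
  show ?thesis
  proof (cases "?S \<times> ?T \<subseteq> E")
    case True
    then show ?thesis using ha hn by blast
  next
    case False
    then obtain x y where "x \<in> ?S" "y \<in> ?T" "(x, y) \<notin> E" by blast
    then have "K\<inverse> `` {y} \<times> K `` {x} \<subseteq> E" "r \<le> card (K\<inverse> `` {y})" "r \<le> card (K `` {x})"
      using cl unfolding cross_linked_def by auto
    then show ?thesis by blast
  qed
qed

text \<open>The largest \<open>K\<close>-degree may occur on either side; if it occurs on the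
  second, the core estimate is applied to the converse relations and the biclique is swapped
  back.\<close>

lemma biclique_of_cross_linked:
  fixes r u :: real and E :: "('a \<times> 'b) set"
  assumes fin: "finite E" and sub: "K \<subseteq> E" and cl: "cross_linked E K"
    and E: "degrees_le E n"
    and u: "0 \<le> u" and card: "(1 - u ^ 4) * (real n)\<^sup>2 \<le> card K"
    and r: "r = (1 - sqrt 8 * u) * n" and rpos: "0 < r"
  shows "\<exists>S T. S \<times> T \<subseteq> E \<and> r \<le> card S \<and> r \<le> card T"
proof -
  have finK: "finite K" using fin sub finite_subset by blast
  have bound: "card (K `` {x}) \<le> card K" "card (K\<inverse> `` {y}) \<le> card K" for x y
  proof -
    have "K `` {x} \<subseteq> snd ` K" "K\<inverse> `` {y} \<subseteq> fst ` K" by force+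
    then show "card (K `` {x}) \<le> card K" "card (K\<inverse> `` {y}) \<le> card K"
      using finK by (auto intro: surj_card_le)
  qed
  \<comment> \<open>The type may be infinite; a maximum exists because the degrees are bounded by
    \<open>card K\<close>. With a trivial predicate, \<open>undefined\<close> is a valid starting
    element.\<close>
  obtain a where a: "\<And>x. card (K `` {x}) \<le> card (K `` {a})"
    using ex_has_greatest_nat[of "\<lambda>_. True" undefined "\<lambda>x. card (K `` {x})" "Suc (card K)"]
      bound(1) by (auto simp: less_Suc_eq_le)
  obtain b where b: "\<And>y. card (K\<inverse> `` {y}) \<le> card (K\<inverse> `` {b})"
    using ex_has_greatest_nat[of "\<lambda>_. True" undefined "\<lambda>y. card (K\<inverse> `` {y})" "Suc (card K)"]
      bound(2) by (auto simp: less_Suc_eq_le)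
  show ?thesis
  proof (cases "card (K\<inverse> `` {b}) \<le> card (K `` {a})")
    case True
    then have "degrees_le K (card (K `` {a}))"
      unfolding degrees_le_def using a b le_trans by blast
    from biclique_of_large_degree[OF fin sub cl E this u card r rpos] show ?thesis .
  next
    case False
    then have "degrees_le (K\<inverse>) (card (K\<inverse> `` {b}))"
      unfolding degrees_le_def using a b by (simp add: le_trans[OF a])
    with biclique_of_large_degree[of "E\<inverse>" "K\<inverse>" n b u r]
    obtain S T where ST: "S \<times> T \<subseteq> E\<inverse>" "r \<le> card S" "r \<le> card T"
      using fin sub cross_linked_converse[OF cl] degrees_le_converse[OF E] u card r rpos by auto
    then have "T \<times> S \<subseteq> E" by auto
    with ST show ?thesis by blast
  qed
qed

section \<open>From relations back to graphs\<close>

lemma complete_bipartite_subgraph: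
  assumes disj: "S \<inter> T = {}" and "S \<subseteq> verts G" "T \<subseteq> verts G"
    and fin: "finite S" "finite T"
    and edge: "\<And>x y. x \<in> S \<Longrightarrow> y \<in> T \<Longrightarrow> {x, y} \<in> edges G"
  shows "\<exists>H. subgraph H G \<and> isomorphic H (complete_bipartite (card S) (card T))"
proof -
  obtain g where g: "bij_betw g S {..<card S}"
    using ex_bij_betw_finite_nat[OF fin(1)] by (auto simp: lessThan_atLeast0)
  obtain h where h: "bij_betw h T {..<card T}"
    using ex_bij_betw_finite_nat[OF fin(2)] by (auto simp: lessThan_atLeast0)
  define f where "f x = (if x \<in> S then Inl (g x) else Inr (h x) :: nat + nat)" for x
  \<comment> \<open>Only the edges between \<open>S\<close> and \<open>T\<close> are kept, because
    \<open>isomorphic\<close> also demands that non-edges correspond.\<close>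
  define H where "H = \<lparr>verts = S \<union> T, edges = {{x, y} | x y. x \<in> S \<and> y \<in> T}\<rparr>"
  have fS: "f x = Inl (g x)" if "x \<in> S" for x using that by (simp add: f_def)
  have fT: "f x = Inr (h x)" if "x \<in> T" for x using that disj by (auto simp: f_def)
  have gS: "g x < card S" if "x \<in> S" for x using g that unfolding bij_betw_def by auto
  have hT: "h x < card T" if "x \<in> T" for x using h that unfolding bij_betw_def by auto
  have "subgraph H G"
    using assms unfolding subgraph_def simple_graph_def H_def by (auto simp: card_insert_if disjoint_iff)
  moreover have "bij_betw f (S \<union> T) (Inl ` {..<card S} \<union> Inr ` {..<card T})"
  proof (rule bij_betw_combine)
    show "bij_betw f S (Inl ` {..<card S})"
      using bij_betw_trans[OF g, of Inl "Inl ` {..<card S}"]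
      by (subst bij_betw_cong[of S f "Inl \<circ> g"]) (auto simp: fS bij_betw_def)
    show "bij_betw f T (Inr ` {..<card T})"
      using bij_betw_trans[OF h, of Inr "Inr ` {..<card T}"]
      by (subst bij_betw_cong[of T f "Inr \<circ> h"]) (auto simp: fT bij_betw_def)
  qed auto
  moreover have "{x, y} \<in> edges H \<longleftrightarrow> {f x, f y} \<in> edges (complete_bipartite (card S) (card T))"
    if "x \<in> S \<union> T" "y \<in> S \<union> T" for x y
    using that disj gS hT
    unfolding H_def complete_bipartite_def
    by (auto simp: fS fT doubleton_eq_iff)
  ultimately show ?thesis
    unfolding isomorphic_def by (intro exI[of _ H]) (auto simp: H_def complete_bipartite_def)
qed

lemma degree_le_max_degree:
  assumes "finite (verts G)" "v \<in> verts G"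
  shows "degree G v \<le> max_degree G"
  unfolding max_degree_def using assms by (intro Max_ge) auto

lemma finite_edges: "finite_simple_graph G \<Longrightarrow> finite (edges G)"
  unfolding finite_simple_graph_def simple_graph_def
  by (rule finite_subset[of _ "Pow (verts G)"]) auto

lemma ex_maximum_clique:
  assumes "finite (verts G)"
  shows "\<exists>K. clique G K \<and> card K = clique_number G"
proof -
  have "finite {K. clique G K}"
    using assms by (rule finite_subset[rotated, OF finite_Pow_iff[THEN iffD2]]) (auto simp: clique_def)
  moreover have "clique G {}" by (simp add: clique_def)
  ultimately have "clique_number G \<in> card ` {K. clique G K}"
    unfolding clique_number_def by (intro Max_in) auto
  then show ?thesis by auto
qed

text \<open>Orients edges from \<open>A\<close> to \<open>B\<close>, turning both the graph and a
  clique of edges into relations. For disjoint sides the orientation of an edge is unique, so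
  cardinalities are preserved.\<close>

definition edge_pairs :: "'a set \<Rightarrow> 'a set \<Rightarrow> 'a set set \<Rightarrow> ('a \<times> 'a) set" where
  "edge_pairs A B F = {(a, b). a \<in> A \<and> b \<in> B \<and> {a, b} \<in> F}"

lemma card_edge_pairs:
  assumes "A \<inter> B = {}" "\<And>e. e \<in> F \<Longrightarrow> \<exists>a\<in>A. \<exists>b\<in>B. e = {a, b}"
  shows "card (edge_pairs A B F) = card F"
proof (rule bij_betw_same_card)
  show "bij_betw (\<lambda>(a, b). {a, b}) (edge_pairs A B F) F"
    using assms unfolding bij_betw_def inj_on_def edge_pairs_def
    by (auto simp: doubleton_eq_iff image_iff) blast
qed

lemma degrees_le_edge_pairs:
  assumes "A \<union> B = verts G" "finite_simple_graph G"
  shows "degrees_le (edge_pairs A B (edges G)) (max_degree G)"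
proof -
  have finV: "finite (verts G)" using assms(2) by (simp add: finite_simple_graph_def)
  \<comment> \<open>\<open>Q\<close> stands for membership in the opposite side, so that one
    injection of neighbours into incident edges serves both sides.\<close>
  have *: "card {y. Q y \<and> {x, y} \<in> edges G} \<le> max_degree G" if x: "x \<in> verts G" for x Q
  proof -
    have "(\<lambda>y. {x, y}) ` {y. Q y \<and> {x, y} \<in> edges G} \<subseteq> {e \<in> edges G. x \<in> e}" by auto
    moreover have "inj_on (\<lambda>y. {x, y}) {y. Q y \<and> {x, y} \<in> edges G}"
      by (auto simp: inj_on_def doubleton_eq_iff)
    ultimately have "card {y. Q y \<and> {x, y} \<in> edges G} \<le> degree G x"
      unfolding degree_def using finite_edges[OF assms(2)] by (intro card_inj_on_le) auto
    then show ?thesis using degree_le_max_degree[OF finV x] by linarith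
  qed
  have "card (edge_pairs A B (edges G) `` {a}) \<le> max_degree G" for a
  proof (cases "a \<in> A")
    case True
    then have "edge_pairs A B (edges G) `` {a} = {y. y \<in> B \<and> {a, y} \<in> edges G}"
      by (auto simp: edge_pairs_def)
    then show ?thesis using *[of a "\<lambda>y. y \<in> B"] True assms(1) by auto
  qed (simp add: edge_pairs_def Image_def)
  moreover have "card ((edge_pairs A B (edges G))\<inverse> `` {b}) \<le> max_degree G" for b
  proof (cases "b \<in> B")
    case True
    then have "(edge_pairs A B (edges G))\<inverse> `` {b} = {y. y \<in> A \<and> {b, y} \<in> edges G}"
      by (auto simp: edge_pairs_def insert_commute)
    then show ?thesis using *[of b "\<lambda>y. y \<in> A"] True assms(1) by auto
  qed (simp add: edge_pairs_def Image_def)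
  ultimately show ?thesis by (simp add: degrees_le_def)
qed

text \<open>For disjoint edges of the clique some edge of \<open>G\<close> joins their ends;
  bipartiteness excludes a join within one side, leaving the two crossing pairs.\<close>

lemma cross_linked_edge_pairs:
  assumes disj: "A \<inter> B = {}"
    and bip: "\<And>e. e \<in> edges G \<Longrightarrow> \<exists>a\<in>A. \<exists>b\<in>B. e = {a, b}"
    and K: "clique (line_graph_square G) K"
  shows "cross_linked (edge_pairs A B (edges G)) (edge_pairs A B K)"
  unfolding cross_linked_def
proof (intro allI impI)
  fix a b a' b'
  assume p: "(a, b) \<in> edge_pairs A B K" and q: "(a', b') \<in> edge_pairs A B K"
  then have mem: "a \<in> A" "b \<in> B" "a' \<in> A" "b' \<in> B" "{a, b} \<in> K" "{a', b'} \<in> K"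
    by (auto simp: edge_pairs_def)
  have KE: "K \<subseteq> edges G" using K by (simp add: clique_def line_graph_square_def)
  have ne: "a \<noteq> b" "a \<noteq> b'" "a' \<noteq> b" "a' \<noteq> b'" using mem disj by auto
  have nAB: "{x, y} \<notin> edges G" if "x \<in> A \<and> y \<in> A \<or> x \<in> B \<and> y \<in> B" for x y
    using bip[of "{x, y}"] that disj by (auto simp: doubleton_eq_iff)
  have "{a, b'} \<in> edges G \<or> {a', b} \<in> edges G"
  proof (cases "a = a' \<or> b = b'")
    \<comment> \<open>If an end is shared, \<open>{a, b'}\<close> is itself one of the two
      edges.\<close>
    case True
    then show ?thesis using mem KE by auto
  next
    case False
    then have "{a, b} \<noteq> {a', b'}" using ne by (auto simp: doubleton_eq_iff)
    then have "{{a, b}, {a', b'}} \<in> edges (line_graph_square G)"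
      using K mem(5,6) unfolding clique_def by simp
    then have "\<exists>e f. {{a, b}, {a', b'}} = {e, f} \<and> e \<in> edges G \<and> f \<in> edges G \<and> e \<noteq> f \<and>
        (e \<inter> f \<noteq> {} \<or> (\<exists>x\<in>e. \<exists>y\<in>f. {x, y} \<in> edges G))"
      by (simp only: line_graph_square_def ugraph.simps mem_Collect_eq)
    then obtain e f where ef: "{{a, b}, {a', b'}} = {e, f}"
      "e \<inter> f \<noteq> {} \<or> (\<exists>x\<in>e. \<exists>y\<in>f. {x, y} \<in> edges G)"
      by (elim exE conjE)
    \<comment> \<open>Edges of the square are unordered pairs, so \<open>e\<close> and
      \<open>f\<close> may be the two given edges in either order.\<close>
    have cases: "e = {a, b} \<and> f = {a', b'} \<or> e = {a', b'} \<and> f = {a, b}"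
      using ef(1) by (simp only: doubleton_eq_iff) blast
    then have "e \<inter> f = {}" using False ne by auto
    with ef(2) obtain x y where xy: "x \<in> e" "y \<in> f" "{x, y} \<in> edges G" by blast
    have "{y, x} \<in> edges G" using xy(3) by (simp only: insert_commute)
    with cases xy have "\<exists>x\<in>{a, b}. \<exists>y\<in>{a', b'}. {x, y} \<in> edges G" by blast
    then obtain x y where "x = a \<or> x = b" "y = a' \<or> y = b'" "{x, y} \<in> edges G" by blast
    then show ?thesis using nAB mem by (auto simp: insert_commute)
  qed
  then show "(a, b') \<in> edge_pairs A B (edges G) \<or> (a', b) \<in> edge_pairs A B (edges G)"
    using mem by (auto simp: edge_pairs_def)
qed

(* The real number r = (1 - sqrt 8 * root 4 \<epsilon>) * max_degree G need not be an integer;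
   it is rounded up, so both parts have at least r vertices. If r is negative, nat gives 0. *)
theorem theorem6:
  fixes G :: "'a ugraph" and \<epsilon> :: real
  assumes "0 \<le> \<epsilon>" and "\<epsilon> \<le> 1"
    and "finite_simple_graph G" and "bipartite G"
    and "real (clique_number (line_graph_square G)) \<ge> (1 - \<epsilon>) * (real (max_degree G))\<^sup>2"
  shows "\<exists>H. subgraph H G \<and>
    isomorphic H (let r = nat \<lceil>(1 - sqrt 8 * root 4 \<epsilon>) * real (max_degree G)\<rceil>
                  in complete_bipartite r r)"
proof -
  define r where "r = (1 - sqrt 8 * root 4 \<epsilon>) * real (max_degree G)"
  have "\<exists>S T. S \<inter> T = {} \<and> S \<subseteq> verts G \<and> T \<subseteq> verts G \<and> card S = nat \<lceil>r\<rceil> \<and> card T = nat \<lceil>r\<rceil> \<and>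
          finite S \<and> finite T \<and> (\<forall>x\<in>S. \<forall>y\<in>T. {x, y} \<in> edges G)"
  proof (cases "0 < r")
    \<comment> \<open>The required size is then 0 and empty parts suffice.\<close>
    case False
    then show ?thesis by (intro exI[of _ "{}"]) simp
  next
    case True
    from \<open>bipartite G\<close> obtain A B where AB: "A \<union> B = verts G" "A \<inter> B = {}"
      and edge: "\<forall>e\<in>edges G. \<exists>a\<in>A. \<exists>b\<in>B. e = {a, b}"
      unfolding bipartite_def by (elim exE conjE)
    have finE: "finite (edges G)" using assms(3) by (rule finite_edges)
    obtain K where K: "clique (line_graph_square G) K"
      "card K = clique_number (line_graph_square G)"
      using ex_maximum_clique[of "line_graph_square G"] finE by (auto simp: line_graph_square_def)
    have KE: "K \<subseteq> edges G" using K(1) by (simp add: clique_def line_graph_square_def)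
    let ?E = "edge_pairs A B (edges G)"
    have finV: "finite (verts G)" using assms(3) by (simp add: finite_simple_graph_def)
    have subAB: "?E \<subseteq> A \<times> B" by (auto simp: edge_pairs_def)
    have finAB: "finite (A \<times> B)" using finV unfolding AB(1)[symmetric] by simp
    have "(1 - root 4 \<epsilon> ^ 4) * (real (max_degree G))\<^sup>2 \<le> card (edge_pairs A B K)"
    proof -
      have "card (edge_pairs A B K) = card K"
        using AB(2) by (rule card_edge_pairs) (use edge KE in auto)
      then show ?thesis using assms(1,5) K(2) by simp
    qed
    moreover have "edge_pairs A B K \<subseteq> ?E" using KE by (auto simp: edge_pairs_def)
    moreover have "0 \<le> root 4 \<epsilon>" using assms(1) by simp
    ultimately obtain S T where ST: "S \<times> T \<subseteq> ?E" "r \<le> card S" "r \<le> card T"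
      using biclique_of_cross_linked[OF finite_subset[OF subAB finAB] _
          cross_linked_edge_pairs[OF AB(2) bspec[OF edge] K(1)] degrees_le_edge_pairs[OF AB(1) assms(3)] _ _ r_def True]
      by blast
    \<comment> \<open>A natural number that is at least \<open>r\<close> is at least its ceiling, so
      both parts can be trimmed to exactly the required size.\<close>
    obtain S' where S': "S' \<subseteq> S" "card S' = nat \<lceil>r\<rceil>" "finite S'"
      using obtain_subset_with_card_n[of "nat \<lceil>r\<rceil>" S] ST(2) by (auto simp: ceiling_le_iff nat_le_iff)
    obtain T' where T': "T' \<subseteq> T" "card T' = nat \<lceil>r\<rceil>" "finite T'"
      using obtain_subset_with_card_n[of "nat \<lceil>r\<rceil>" T] ST(3) by (auto simp: ceiling_le_iff nat_le_iff)
    \<comment> \<open>An empty factor would make the product empty and leave the other part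
      unconstrained; nonempty parts place each in its own side.\<close>
    have "S' \<noteq> {}" "T' \<noteq> {}" using S' T' True by auto
    then have "S' \<subseteq> A" "T' \<subseteq> B" using ST(1) S'(1) T'(1) subAB by blast+
    moreover have "{x, y} \<in> edges G" if "x \<in> S'" "y \<in> T'" for x y
      using that S'(1) T'(1) ST(1) by (auto simp: edge_pairs_def)
    ultimately show ?thesis
      using AB(1,2) S' T' by (intro exI[of _ S'] exI[of _ T']) auto
  qed
  then obtain S T where "S \<inter> T = {}" "S \<subseteq> verts G" "T \<subseteq> verts G" "card S = nat \<lceil>r\<rceil>" "card T = nat \<lceil>r\<rceil>"
    "finite S" "finite T" "\<forall>x\<in>S. \<forall>y\<in>T. {x, y} \<in> edges G" by blast
  then show ?thesis
    using complete_bipartite_subgraph[of S T G] by (auto simp: r_def Let_def)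
qed

end
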